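(* Let $\alpha,\beta\in\mathcal{A}$. (a) If $x,y\in\beta N$ satisfy $x\supseteq F_\alpha$, $y\supseteq F_\beta$ and $x\,\widetilde{\mid}\,y$, then $\alpha\leq\beta$. (b) If $\alpha\neq\beta$, then there is no ultrafilter $x\in\beta N$ with $x\supseteq F_\alpha\cup F_\beta$.
   Context: $N=\{1,2,3,\dots\}$; $\beta N$ is the set of ultrafilters on $N$, each $n\in N$ being identified with the principal ultrafilter at $n$; $\overline{A}=\{x\in\beta N: A\in x\}$ for $A\subseteq N$. $P$ is the set of prime numbers. For $A\subseteq N$ let $A\uparrow=\{n\in N:\exists a\in A,\ a\mid n\}$ and $\mathcal{U}=\{A\subseteq N: A=A\uparrow\}$. For $x,y\in\beta N$, $x\,\widetilde{\mid}\,y$ iff $x\cap\mathcal{U}\subseteq y$. For $A\subseteq N$, $A^k=\{a^k:a\in A\}$; for an ultrafilter $p$, $p^k=\{B\subseteq N:\{a\in N: a^k\in B\}\in p\}$. For $p\in\overline{P}$, $p\restriction P=\{X\cap P:X\in p\}$. A basic ultrafilter is one of the form $p^k$ with $p\in\overline{P}$, $k\in N$ (it determines $p$ and $k$); $\mathcal{B}$ is the set of all basic ultrafilters. $\mathcal{A}$ is the set of all functions $\alpha:\mathcal{B}\to N\cup\{0\}$ with finite support. One writes $\alpha=\{(p_1^{k_1},n_1),\dots,(p_m^{k_m},n_m)\}$, with $p_i^{k_i}$ pairwise distinct, if $\alpha(p_i^{k_i})=n_i$ for all $i$ and $\alpha(b)=0$ for all other $b\in\mathcal{B}$ (some $n_i$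 may be $0$). For such $\alpha$, $F_\alpha$ is the family of all sets $$(A_1^{k_1})^{(n_1)}\cdots(A_m^{k_m})^{(n_m)}=\Big\{\prod_{i=1}^m\prod_{j=1}^{n_i}a_{i,j}^{k_i}: a_{i,j}\in A_i\text{ for all }i,j,\text{ and all }a_{i,j}\text{ are distinct}\Big\}$$ such that (i) $A_i\in p_i\restriction P$, and (ii) $A_i=A_j$ if $p_i=p_j$, and $A_i\cap A_j=\emptyset$ otherwise. (Whether $F_\alpha\subseteq x$ holds does not depend on which terms with $n_i=0$ are listed.) For $\alpha\in\mathcal{A}$ and $p\in\overline{P}$ let $\alpha\restriction p=\langle\alpha(p^k):k\in N\rangle$. For two sequences $\vec{x}=\langle x_k\rangle$, $\vec{y}=\langle y_k\rangle$ in $N\cup\{0\}$ with finitely many nonzero terms, $\vec{y}$ dominates $\vec{x}$ if $\sum_{k\geq m}x_k\leq\sum_{k\geq m}y_k$ for every $m\in N$. Finally, $\alpha\leq\beta$ iff $\beta\restriction p$ dominates $\alpha\restriction p$ for every $p\in\overline{P}$. *)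

theory Defs
  imports "HOL-Computational_Algebra.Primes"
begin

text \<open>An ultrafilter is a family of subsets of \<open>Npos\<close>, i.e. a set of sets of positive
  integers (it never contains a set that has 0 as an element).\<close>

definition Npos :: "nat set" where
  "Npos = {n. 1 \<le> n}"

definition Primes :: "nat set" where
  "Primes = {n. prime n}"

definition betaN :: "nat set set set" where
  "betaN = {x. x \<subseteq> Pow Npos \<and> Npos \<in> x \<and> {} \<notin> x
              \<and> (\<forall>A\<in>x. \<forall>B\<in>x. A \<inter> B \<in> x)
              \<and> (\<forall>A\<in>x. \<forall>B. A \<subseteq> B \<and> B \<subseteq> Npos \<longrightarrow> B \<in> x)
              \<and> (\<forall>A. A \<subseteq> Npos \<longrightarrow> A \<in> x \<or> Npos - A \<in> x)}"

definition betacl :: "nat set \<Rightarrow> nat set set set" where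
  "betacl A = {x \<in> betaN. A \<in> x}"

definition upclose :: "nat set \<Rightarrow> nat set" where
  "upclose A = {n \<in> Npos. \<exists>a\<in>A. a dvd n}"

definition Upsets :: "nat set set" where
  "Upsets = {A. A \<subseteq> Npos \<and> A = upclose A}"

definition tilde_dvd :: "nat set set \<Rightarrow> nat set set \<Rightarrow> bool" where
  "tilde_dvd x y \<longleftrightarrow> x \<inter> Upsets \<subseteq> y"

definition upow :: "nat set set \<Rightarrow> nat \<Rightarrow> nat set set" where
  "upow p k = {B. B \<subseteq> Npos \<and> {a \<in> Npos. a ^ k \<in> B} \<in> p}"

definition restrP :: "nat set set \<Rightarrow> nat set set" where
  "restrP p = {X \<inter> Primes | X. X \<in> p}"

definition Basic :: "nat set set set" where
  "Basic = {upow p k | p k. p \<in> betacl Primes \<and> k \<in> Npos}"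

text \<open>A function on \<open>Basic\<close> is represented by its extension by 0, so that equality of
  functions on \<open>Basic\<close> is equality in HOL.\<close>

definition Alphas :: "(nat set set \<Rightarrow> nat) set" where
  "Alphas = {\<alpha>. (\<forall>b. b \<notin> Basic \<longrightarrow> \<alpha> b = 0) \<and> finite {b. \<alpha> b \<noteq> 0}}"

text \<open>A term \<open>(p\<^sub>i\<^bsup>k\<^sub>i\<^esup>, n\<^sub>i)\<close> of \<open>\<alpha>\<close> is indexed by the pair \<open>(p\<^sub>i, k\<^sub>i)\<close>, which
  \<open>p\<^sub>i\<^bsup>k\<^sub>i\<^esup>\<close> determines (lemma \<open>upow_inj\<close>), and \<open>n\<^sub>i = \<alpha> (upow p\<^sub>i k\<^sub>i)\<close>. A listing of
  \<open>\<alpha>\<close> is a finite set \<open>L\<close> of such pairs that covers the support of \<open>\<alpha>\<close>.\<close>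

definition is_listing :: "(nat set set \<Rightarrow> nat) \<Rightarrow> (nat set set \<times> nat) set \<Rightarrow> bool" where
  "is_listing \<alpha> L \<longleftrightarrow> finite L \<and> L \<subseteq> betacl Primes \<times> Npos
     \<and> {b. \<alpha> b \<noteq> 0} \<subseteq> (\<lambda>(p, k). upow p k) ` L"

text \<open>The product set \<open>(A\<^sub>1\<^bsup>k\<^sub>1\<^esup>)\<^bsup>(n\<^sub>1)\<^esup> \<cdots> (A\<^sub>m\<^bsup>k\<^sub>m\<^esup>)\<^bsup>(n\<^sub>m)\<^esup>\<close>, where \<open>A i\<close>
  is the set attached to the term \<open>i = (p, k)\<close>. All factors \<open>a i j\<close> are distinct, also
  across different terms.\<close>

definition prodset ::
  "(nat set set \<Rightarrow> nat) \<Rightarrow> (nat set set \<times> nat) set \<Rightarrow> (nat set set \<times> nat \<Rightarrow> nat set) \<Rightarrow> nat set"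
  where
  "prodset \<alpha> L A =
     {\<Prod>(p, k)\<in>L. \<Prod>j = 1..\<alpha> (upow p k). a (p, k) j ^ k | a.
        (\<forall>(p, k)\<in>L. \<forall>j\<in>{1..\<alpha> (upow p k)}. a (p, k) j \<in> A (p, k))
        \<and> inj_on (\<lambda>(i, j). a i j) (SIGMA i:L. {1..\<alpha> (upow (fst i) (snd i))})}"

definition Fam_on ::
  "(nat set set \<Rightarrow> nat) \<Rightarrow> (nat set set \<times> nat) set \<Rightarrow> nat set set" where
  "Fam_on \<alpha> L =
     {prodset \<alpha> L A | A.
        (\<forall>(p, k)\<in>L. A (p, k) \<in> restrP p)
        \<and> (\<forall>(p, k)\<in>L. \<forall>(q, l)\<in>L.
              if p = q then A (p, k) = A (q, l) else A (p, k) \<inter> A (q, l) = {})}"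

text \<open>The terms with \<open>n\<^sub>i \<noteq> 0\<close>. They form the smallest listing of \<open>\<alpha>\<close> (lemmas
  \<open>is_listing_suppterms\<close>, \<open>suppterms_subset\<close>), and by lemma \<open>Fam_on_subset_iff\<close> any other listing may be used
  instead.\<close>

definition suppterms :: "(nat set set \<Rightarrow> nat) \<Rightarrow> (nat set set \<times> nat) set" where
  "suppterms \<alpha> = {(p, k). p \<in> betacl Primes \<and> k \<in> Npos \<and> \<alpha> (upow p k) \<noteq> 0}"

definition Fam :: "(nat set set \<Rightarrow> nat) \<Rightarrow> nat set set" where
  "Fam \<alpha> = Fam_on \<alpha> (suppterms \<alpha>)"

definition restr :: "(nat set set \<Rightarrow> nat) \<Rightarrow> nat set set \<Rightarrow> nat \<Rightarrow> nat" where
  "restr \<alpha> p = (\<lambda>k. \<alpha> (upow p k))"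

text \<open>For sequences with finitely many nonzero terms, indexed by \<open>Npos\<close> (the value at 0 is
  never used); the tail sums run over the nonzero terms, hence over a finite set.\<close>

definition dominates :: "(nat \<Rightarrow> nat) \<Rightarrow> (nat \<Rightarrow> nat) \<Rightarrow> bool" where
  "dominates y x \<longleftrightarrow>
     (\<forall>m\<in>Npos. (\<Sum>k | m \<le> k \<and> x k \<noteq> 0. x k) \<le> (\<Sum>k | m \<le> k \<and> y k \<noteq> 0. y k))"

definition alpha_le :: "(nat set set \<Rightarrow> nat) \<Rightarrow> (nat set set \<Rightarrow> nat) \<Rightarrow> bool" where
  "alpha_le \<alpha> \<beta> \<longleftrightarrow> (\<forall>p\<in>betacl Primes. dominates (restr \<beta> p) (restr \<alpha> p))"

lemma betaN_Int: "x \<in> betaN \<Longrightarrow> A \<in> x \<Longrightarrow> B \<in> x \<Longrightarrow> A \<inter> B \<in> x"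
  by (simp add: betaN_def)

lemma betaN_up: "x \<in> betaN \<Longrightarrow> A \<in> x \<Longrightarrow> A \<subseteq> B \<Longrightarrow> B \<subseteq> Npos \<Longrightarrow> B \<in> x"
  by (simp add: betaN_def)

lemma betaN_sub: "x \<in> betaN \<Longrightarrow> A \<in> x \<Longrightarrow> A \<subseteq> Npos"
  by (auto simp only: betaN_def mem_Collect_eq Pow_iff dest: subsetD)

lemma betaN_nonempty: "x \<in> betaN \<Longrightarrow> A \<in> x \<Longrightarrow> A \<noteq> {}"
  by (auto simp only: betaN_def mem_Collect_eq)

lemma betaN_compl:
  assumes "x \<in> betaN" "A \<subseteq> Npos" "A \<notin> x"
  shows "Npos - A \<in> x"
proof -
  have "\<forall>A. A \<subseteq> Npos \<longrightarrow> A \<in> x \<or> Npos - A \<in> x"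
    using assms(1) by (simp add: betaN_def)
  then have "A \<subseteq> Npos \<longrightarrow> A \<in> x \<or> Npos - A \<in> x" by (rule spec)
  with assms(2,3) show ?thesis by simp
qed

lemma Primes_Npos: "Primes \<subseteq> Npos"
  by (auto simp: Primes_def Npos_def dest: prime_ge_1_nat)

lemma power_Npos: "a \<in> Npos \<Longrightarrow> a ^ k \<in> Npos"
  by (simp add: Npos_def)

lemma upow_image:
  assumes p: "p \<in> betaN" and A: "A \<in> p"
  shows "(\<lambda>a. a ^ k) ` A \<in> upow p k"
proof -
  have "A \<subseteq> {a \<in> Npos. a ^ k \<in> (\<lambda>a. a ^ k) ` A}"
    using betaN_sub[OF p A] by auto
  then have "{a \<in> Npos. a ^ k \<in> (\<lambda>a. a ^ k) ` A} \<in> p"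
    using betaN_up[OF p A] by auto
  then show ?thesis
    unfolding upow_def using betaN_sub[OF p A] power_Npos by auto
qed

lemma upow_subset:
  assumes p: "p \<in> betacl Primes" and q: "q \<in> betacl Primes" and k: "k \<in> Npos"
    and eq: "upow p k = upow q k"
  shows "p \<subseteq> q"
proof
  fix A assume A: "A \<in> p"
  have p': "p \<in> betaN" and q': "q \<in> betaN" using p q by (auto simp: betacl_def)
  from upow_image[OF p' A, of k] have "(\<lambda>a. a ^ k) ` A \<in> upow q k" by (simp add: eq)
  then have *: "{a \<in> Npos. a ^ k \<in> (\<lambda>a. a ^ k) ` A} \<in> q" by (simp add: upow_def)
  have "{a \<in> Npos. a ^ k \<in> (\<lambda>a. a ^ k) ` A} \<subseteq> A"
  proof
    fix a assume "a \<in> {a \<in> Npos. a ^ k \<in> (\<lambda>a. a ^ k) ` A}"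
    then obtain c where "c \<in> A" "a ^ k = c ^ k" by auto
    moreover have "a = c"
      using \<open>a ^ k = c ^ k\<close> k by (auto simp: Npos_def intro: power_eq_imp_eq_base)
    ultimately show "a \<in> A" by simp
  qed
  with * show "A \<in> q" using betaN_up[OF q'] betaN_sub[OF p' A] by blast
qed

lemma upow_inj:
  assumes p: "p \<in> betacl Primes" and q: "q \<in> betacl Primes"
    and k: "k \<in> Npos" and l: "l \<in> Npos" and eq: "upow p k = upow q l"
  shows "p = q \<and> k = l"
proof -
  have p': "p \<in> betaN" "Primes \<in> p" and q': "q \<in> betaN" "Primes \<in> q"
    using p q by (auto simp: betacl_def)
  have "(\<lambda>a. a ^ l) ` Primes \<in> upow p k" using upow_image[OF q', of l] by (simp add: eq)
  then have "{a \<in> Npos. a ^ k \<in> (\<lambda>a. a ^ l) ` Primes} \<in> p" by (simp add: upow_def)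
  from betaN_nonempty[OF p'(1) betaN_Int[OF p'(1) this p'(2)]]
  obtain a where a: "a \<in> Primes" "a ^ k \<in> (\<lambda>a. a ^ l) ` Primes" by blast
  then obtain c where ac: "prime a" "prime c" "a ^ k = c ^ l" by (auto simp: Primes_def)
  have kl: "k > 0" "l > 0" using k l by (auto simp: Npos_def)
  have "a dvd c ^ l" using ac(3) kl(1) by (metis dvd_power)
  then have "a = c" using ac prime_dvd_power primes_dvd_imp_eq by blast
  then have "k = l" using ac prime_gt_1_nat power_inject_exp by blast
  moreover have "p = q"
    using upow_subset[OF p q k] upow_subset[OF q p k] eq \<open>k = l\<close> by auto
  ultimately show ?thesis by simp
qed

lemma is_listing_suppterms:
  assumes "\<alpha> \<in> Alphas"
  shows "is_listing \<alpha> (suppterms \<alpha>)"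
proof -
  let ?u = "\<lambda>(p, k). upow p k"
  have inj: "inj_on ?u (suppterms \<alpha>)"
  proof (rule inj_onI, clarify)
    fix p k q l
    assume "(p, k) \<in> suppterms \<alpha>" "(q, l) \<in> suppterms \<alpha>" "upow p k = upow q l"
    then show "p = q \<and> k = l" using upow_inj[of p q k l] by (simp add: suppterms_def)
  qed
  have "?u ` suppterms \<alpha> \<subseteq> {b. \<alpha> b \<noteq> 0}" by (auto simp: suppterms_def)
  moreover have "finite {b. \<alpha> b \<noteq> 0}" using assms by (simp add: Alphas_def)
  ultimately have "finite (suppterms \<alpha>)" by (rule inj_on_finite[OF inj])
  moreover have "{b. \<alpha> b \<noteq> 0} \<subseteq> ?u ` suppterms \<alpha>"
  proof
    fix b assume b: "b \<in> {b. \<alpha> b \<noteq> 0}"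
    then have "b \<in> Basic" using assms by (auto simp: Alphas_def)
    then obtain p k where pk: "b = upow p k" "p \<in> betacl Primes" "k \<in> Npos"
      by (auto simp: Basic_def)
    with b have "(p, k) \<in> suppterms \<alpha>" by (simp add: suppterms_def)
    then show "b \<in> ?u ` suppterms \<alpha>" by (rule rev_image_eqI) (simp add: pk)
  qed
  moreover have "suppterms \<alpha> \<subseteq> betacl Primes \<times> Npos"
    unfolding suppterms_def by blast
  ultimately show ?thesis unfolding is_listing_def by (intro conjI)
qed

lemma betaN_distinct:
  assumes p: "p \<in> betaN" and q: "q \<in> betaN" and ne: "p \<noteq> q"
  shows "\<exists>A\<in>p. A \<notin> q"
proof (rule ccontr)
  assume "\<not> (\<exists>A\<in>p. A \<notin> q)"
  then have sub: "p \<subseteq> q" by blast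
  have "q \<subseteq> p"
  proof
    fix A assume A: "A \<in> q"
    show "A \<in> p"
    proof (rule ccontr)
      assume "A \<notin> p"
      then have "Npos - A \<in> p" using betaN_compl[OF p betaN_sub[OF q A]] by simp
      then have "A \<inter> (Npos - A) \<in> q" using betaN_Int[OF q A] sub by blast
      then show False using betaN_nonempty[OF q] by blast
    qed
  qed
  with sub ne show False by blast
qed

lemma restrP_iff:
  assumes "p \<in> betacl Primes"
  shows "A \<in> restrP p \<longleftrightarrow> A \<in> p \<and> A \<subseteq> Primes"
  using assms betaN_Int[of p _ Primes] by (auto simp: restrP_def betacl_def)

lemma betaN_finite_Int:
  assumes x: "x \<in> betaN" and "finite I" and "\<And>i. i \<in> I \<Longrightarrow> f i \<in> x" and "B \<in> x"
  shows "B \<inter> (\<Inter>i\<in>I. f i) \<in> x"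
  using assms(2,3)
proof (induction I rule: finite_induct)
  case empty
  then show ?case using assms(4) by simp
next
  case (insert i I)
  have "B \<inter> (\<Inter>i\<in>insert i I. f i) = f i \<inter> (B \<inter> (\<Inter>i\<in>I. f i))" by blast
  then show ?case using insert betaN_Int[OF x, of "f i"] by simp
qed

lemma separate_finite:
  assumes fin: "finite S" and S: "S \<subseteq> betacl Primes"
  obtains D where "\<And>p. p \<in> S \<Longrightarrow> D p \<in> p" "\<And>p. D p \<subseteq> Primes"
    "\<And>p q. p \<in> S \<Longrightarrow> q \<in> S \<Longrightarrow> p \<noteq> q \<Longrightarrow> D p \<inter> D q = {}"
proof -
  have bn: "p \<in> betaN" and pr: "Primes \<in> p" if "p \<in> S" for p
    using that S by (auto simp: betacl_def)
  define W where "W p q = (SOME A. A \<in> p \<and> A \<notin> q)" for p q :: "nat set set"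
  have W: "W p q \<in> p \<and> W p q \<notin> q" if "p \<in> S" "q \<in> S" "p \<noteq> q" for p q
    unfolding W_def by (rule someI_ex) (use betaN_distinct[OF bn bn] that in blast)
  define C where "C p q = W p q \<inter> (Npos - W q p)" for p q
  have C: "C p q \<in> p" if "p \<in> S" "q \<in> S" "p \<noteq> q" for p q
  proof -
    have "W q p \<notin> p" "W q p \<subseteq> Npos" using W[of q p] that betaN_sub[OF bn] by auto
    then have "Npos - W q p \<in> p" using betaN_compl[OF bn[OF that(1)]] by simp
    then show ?thesis unfolding C_def using W[OF that] betaN_Int[OF bn[OF that(1)]] by blast
  qed
  define D where "D p = Primes \<inter> (\<Inter>q\<in>S - {p}. C p q)" for p
  show thesis
  proof (rule that[of D])
    show "D p \<in> p" if "p \<in> S" for p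
      unfolding D_def by (rule betaN_finite_Int) (use that bn pr C fin in auto)
    show "D p \<subseteq> Primes" for p by (auto simp: D_def)
    show "D p \<inter> D q = {}" if "p \<in> S" "q \<in> S" "p \<noteq> q" for p q
      using that by (auto simp: D_def C_def)
  qed
qed

lemma prodset_mono:
  assumes "\<And>p k. (p, k) \<in> L \<Longrightarrow> A (p, k) \<subseteq> B (p, k)"
  shows "prodset \<alpha> L A \<subseteq> prodset \<alpha> L B"
  unfolding prodset_def
proof (rule Collect_mono, intro impI, elim exE conjE, goal_cases)
  case (1 x a)
  have "\<forall>(p, k)\<in>L. \<forall>j\<in>{1..\<alpha> (upow p k)}. a (p, k) j \<in> B (p, k)"
    using 1(2) assms by blast
  with 1(1,3) show ?case by blast
qed

lemma suppterms_subset: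
  assumes "is_listing \<alpha> L"
  shows "suppterms \<alpha> \<subseteq> L"
proof
  fix i assume i: "i \<in> suppterms \<alpha>"
  obtain p k where [simp]: "i = (p, k)" by (cases i)
  from i have pk: "p \<in> betacl Primes" "k \<in> Npos" "\<alpha> (upow p k) \<noteq> 0"
    by (auto simp: suppterms_def)
  then have "upow p k \<in> (\<lambda>(p, k). upow p k) ` L" using assms by (auto simp: is_listing_def)
  then obtain q l where ql: "(q, l) \<in> L" "upow p k = upow q l" by auto
  then have "q \<in> betacl Primes" "l \<in> Npos" using assms by (auto simp: is_listing_def)
  then show "i \<in> L" using upow_inj[OF pk(1) _ pk(2) _ ql(2)] ql(1) by simp
qed

lemma prodset_listing:
  assumes L: "is_listing \<alpha> L"
  shows "prodset \<alpha> L A = prodset \<alpha> (suppterms \<alpha>) A"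
proof -
  let ?T = "suppterms \<alpha>"
  have sub: "?T \<subseteq> L" by (rule suppterms_subset[OF L])
  have zero: "\<alpha> (upow p k) = 0" if "(p, k) \<in> L - ?T" for p k
    using that L by (auto simp: is_listing_def suppterms_def)
  have 1: "(\<Prod>(p, k)\<in>L. \<Prod>j = 1..\<alpha> (upow p k). a (p, k) j ^ k)
        = (\<Prod>(p, k)\<in>?T. \<Prod>j = 1..\<alpha> (upow p k). a (p, k) j ^ k)"
    for a :: "nat set set \<times> nat \<Rightarrow> nat \<Rightarrow> nat"
    by (rule prod.mono_neutral_right)
       (use L sub zero in \<open>auto simp: is_listing_def\<close>)
  have 2: "(SIGMA i:L. {1..\<alpha> (upow (fst i) (snd i))})
        = (SIGMA i:?T. {1..\<alpha> (upow (fst i) (snd i))})"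
  proof (rule set_eqI, clarify, goal_cases)
    case (1 p k j)
    show ?case
    proof (cases "(p, k) \<in> ?T")
      case True
      then show ?thesis using sub by auto
    next
      case False
      then show ?thesis using zero[of p k] by auto
    qed
  qed
  have 3: "(\<forall>(p, k)\<in>L. \<forall>j\<in>{1..\<alpha> (upow p k)}. a (p, k) j \<in> A (p, k))
      = (\<forall>(p, k)\<in>?T. \<forall>j\<in>{1..\<alpha> (upow p k)}. a (p, k) j \<in> A (p, k))"
    for a :: "nat set set \<times> nat \<Rightarrow> nat \<Rightarrow> nat"
  proof
    assume "\<forall>(p, k)\<in>L. \<forall>j\<in>{1..\<alpha> (upow p k)}. a (p, k) j \<in> A (p, k)"
    then show "\<forall>(p, k)\<in>?T. \<forall>j\<in>{1..\<alpha> (upow p k)}. a (p, k) j \<in> A (p, k)"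
      using sub by blast
  next
    assume *: "\<forall>(p, k)\<in>?T. \<forall>j\<in>{1..\<alpha> (upow p k)}. a (p, k) j \<in> A (p, k)"
    have "a (p, k) j \<in> A (p, k)" if "(p, k) \<in> L" "j \<in> {1..\<alpha> (upow p k)}" for p k j
    proof -
      have "(p, k) \<in> ?T" using zero[of p k] that by auto
      with * that(2) show ?thesis by blast
    qed
    then show "\<forall>(p, k)\<in>L. \<forall>j\<in>{1..\<alpha> (upow p k)}. a (p, k) j \<in> A (p, k)" by blast
  qed
  show ?thesis unfolding prodset_def 1 2 3 ..
qed

lemma Fam_on_subset_iff:
  assumes x: "x \<in> betaN" and L: "is_listing \<alpha> L"
  shows "Fam_on \<alpha> L \<subseteq> x \<longleftrightarrow> Fam \<alpha> \<subseteq> x"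
proof
  let ?T = "suppterms \<alpha>"
  have sub: "?T \<subseteq> L" by (rule suppterms_subset[OF L])
  have Lcl: "p \<in> betacl Primes" if "(p, k) \<in> L" for p k
    using that L by (auto simp: is_listing_def)
  {
    assume "Fam \<alpha> \<subseteq> x"
    moreover have "Fam_on \<alpha> L \<subseteq> Fam \<alpha>"
    proof
      fix X assume "X \<in> Fam_on \<alpha> L"
      then obtain A where X: "X = prodset \<alpha> L A"
        and 1: "\<forall>(p, k)\<in>L. A (p, k) \<in> restrP p"
        and 2: "\<forall>(p, k)\<in>L. \<forall>(q, l)\<in>L.
              if p = q then A (p, k) = A (q, l) else A (p, k) \<inter> A (q, l) = {}"
        unfolding Fam_on_def by blast
      have "\<forall>(p, k)\<in>?T. A (p, k) \<in> restrP p" using 1 sub by blast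
      moreover have "\<forall>(p, k)\<in>?T. \<forall>(q, l)\<in>?T.
              if p = q then A (p, k) = A (q, l) else A (p, k) \<inter> A (q, l) = {}"
        using 2 sub by blast
      ultimately show "X \<in> Fam \<alpha>"
        unfolding Fam_def Fam_on_def X prodset_listing[OF L] by blast
    qed
    ultimately show "Fam_on \<alpha> L \<subseteq> x" by blast
  next
    assume LX: "Fam_on \<alpha> L \<subseteq> x"
    show "Fam \<alpha> \<subseteq> x"
    proof
      fix X assume "X \<in> Fam \<alpha>"
      then obtain A where X: "X = prodset \<alpha> ?T A"
        and 1: "\<And>p k. (p, k) \<in> ?T \<Longrightarrow> A (p, k) \<in> restrP p"
        and 2: "\<forall>(p, k)\<in>?T. \<forall>(q, l)\<in>?T.
              if p = q then A (p, k) = A (q, l) else A (p, k) \<inter> A (q, l) = {}"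
        unfolding Fam_def Fam_on_def by blast
      have "finite (fst ` L)" "fst ` L \<subseteq> betacl Primes"
        using L by (auto simp: is_listing_def)
      then obtain D where D: "\<And>p. p \<in> fst ` L \<Longrightarrow> D p \<in> p" "\<And>p. D p \<subseteq> Primes"
        "\<And>p q. p \<in> fst ` L \<Longrightarrow> q \<in> fst ` L \<Longrightarrow> p \<noteq> q \<Longrightarrow> D p \<inter> D q = {}"
        using separate_finite by blast
      define E where "E p = (if \<exists>k. (p, k) \<in> ?T then D p \<inter> A (p, SOME k. (p, k) \<in> ?T) else D p)" for p
      have E_sub: "E p \<subseteq> D p" for p by (auto simp: E_def)
      have E_A: "E p \<subseteq> A (p, k)" if "(p, k) \<in> ?T" for p k
      proof -
        have "(p, SOME k. (p, k) \<in> ?T) \<in> ?T" using that by (rule someI)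
        with 2 that have "A (p, SOME k. (p, k) \<in> ?T) = A (p, k)" by fastforce
        with that show ?thesis by (auto simp: E_def)
      qed
      have E_in: "E p \<in> p" if "(p, k) \<in> L" for p k
      proof (cases "\<exists>k. (p, k) \<in> ?T")
        case True
        then have "(p, SOME k. (p, k) \<in> ?T) \<in> ?T" by (rule someI_ex)
        then have "A (p, SOME k. (p, k) \<in> ?T) \<in> p"
          using 1 restrP_iff[OF Lcl[OF that]] by blast
        moreover have "D p \<in> p" using D(1) that by force
        moreover have "p \<in> betaN" using Lcl[OF that] by (simp add: betacl_def)
        ultimately show ?thesis using True betaN_Int by (simp add: E_def)
      next
        case False
        then have "E p = D p" by (simp add: E_def)
        with D(1) that show ?thesis by force
      qed
      define B where "B = (\<lambda>(p, k :: nat). E p)"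
      have B [simp]: "B (p, k) = E p" for p k by (simp add: B_def)
      have E_restr: "E p \<in> restrP p" if "(p, k) \<in> L" for p k
        using restrP_iff[OF Lcl[OF that]] E_in[OF that] E_sub[of p] D(2)[of p] by auto
      have E_disj: "E p \<inter> E q = {}" if "(p, k) \<in> L" "(q, l) \<in> L" "p \<noteq> q" for p k q l
      proof -
        have "p \<in> fst ` L" "q \<in> fst ` L" using that(1,2) by (force, force)
        then have "D p \<inter> D q = {}" using D(3) that(3) by simp
        with E_sub show ?thesis by blast
      qed
      have B1: "\<forall>(p, k)\<in>L. B (p, k) \<in> restrP p"
        using E_restr by auto
      have B2: "\<forall>(p, k)\<in>L. \<forall>(q, l)\<in>L.
              if p = q then B (p, k) = B (q, l) else B (p, k) \<inter> B (q, l) = {}"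
      proof (intro ballI, clarify)
        fix p k q l assume "(p, k) \<in> L" "(q, l) \<in> L"
        then show "if p = q then B (p, k) = B (q, l) else B (p, k) \<inter> B (q, l) = {}"
          using E_disj by simp
      qed
      have "prodset \<alpha> L B \<in> Fam_on \<alpha> L"
        unfolding Fam_on_def mem_Collect_eq using B1 B2 by (intro exI[of _ B] conjI refl)
      then have "prodset \<alpha> ?T B \<in> x" using LX unfolding prodset_listing[OF L] by (rule rev_subsetD)
      moreover have "prodset \<alpha> ?T B \<subseteq> X"
        unfolding X by (rule prodset_mono) (simp add: E_A)
      moreover have "X \<subseteq> Npos"
      proof
        fix n assume "n \<in> X"
        then obtain a where n: "n = (\<Prod>(p, k)\<in>?T. \<Prod>j = 1..\<alpha> (upow p k). a (p, k) j ^ k)"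
          and a: "\<forall>(p, k)\<in>?T. \<forall>j\<in>{1..\<alpha> (upow p k)}. a (p, k) j \<in> A (p, k)"
          unfolding X prodset_def by blast
        have "a (p, k) j > 0" if "(p, k) \<in> ?T" "j \<in> {1..\<alpha> (upow p k)}" for p k j
        proof -
          have "a (p, k) j \<in> A (p, k)" using a that by blast
          then have "a (p, k) j \<in> Npos"
            using 1[OF that(1)] restrP_iff[OF Lcl[OF subsetD[OF sub that(1)]]] Primes_Npos
            by auto
          then show ?thesis by (simp add: Npos_def)
        qed
        then have "n > 0" unfolding n by (auto intro!: prod_pos)
        then show "n \<in> Npos" by (simp add: Npos_def)
      qed
      ultimately show "X \<in> x" by (rule betaN_up[OF x])
    qed
  }
qed

end

theory Submission imports Defs begin

text \<open>Fix pairwise disjoint sets of primes \<open>D q \<in> q\<close>, one for each of the finitely many \<open>q\<close>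
  involved. The number of primes in \<open>D p\<close> whose \<open>m\<close>-th power divides \<open>n\<close> is monotone in \<open>n\<close>
  with respect to divisibility, and on the product set of \<open>\<alpha>\<close> built from \<open>D\<close> it is constantly
  the tail sum of \<open>\<alpha> \<restriction> p\<close> from \<open>m\<close> on. If \<open>x\<close> divides \<open>y\<close>, then some element of the product
  set of \<open>\<alpha>\<close> divides some element of the product set of \<open>\<beta>\<close>, which gives (a). For (b), apply
  (a) to \<open>x\<close> and \<open>x\<close> in both directions and use that tail sums determine a sequence.\<close>

text \<open>The bases are distinct primes, so no exponents add up: the multiplicity of a prime is
  the exponent at its unique index, and \<open>b\<close> maps the counted indices bijectively onto
  the counted primes. \<open>R\<close> may be infinite.\<close>

lemma card_multiplicity_prod_primes:
  fixes b :: "'i \<Rightarrow> nat"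
  assumes "finite I" and inj: "inj_on b I" and pr: "\<And>t. t \<in> I \<Longrightarrow> prime (b t)"
    and R: "\<And>r. r \<in> R \<Longrightarrow> prime r" and m: "1 \<le> m"
  shows "card {r \<in> R. m \<le> multiplicity r (\<Prod>t\<in>I. b t ^ e t)} = card {t \<in> I. b t \<in> R \<and> m \<le> e t}"
proof -
  \<comment> \<open>Reindexing by the primes \<open>b t\<close> makes the exponent a function of the
    prime, so that multiplicities can be read off.\<close>
  let ?g = "inv_into I b"
  have "(\<Prod>t\<in>I. b t ^ e t) = (\<Prod>r\<in>b ` I. r ^ e (?g r))"
    using inj by (simp add: prod.reindex)
  then have mult: "multiplicity r (\<Prod>t\<in>I. b t ^ e t) = (if r \<in> b ` I then e (?g r) else 0)"
    if "r \<in> R" for r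
  proof -
    have "\<And>q. q \<in> b ` I \<Longrightarrow> prime q" using pr by blast
    from multiplicity_prod_prime_powers[OF _ this R[OF that], where f = "\<lambda>r. e (?g r)"] assms(1)
    show ?thesis using \<open>(\<Prod>t\<in>I. b t ^ e t) = _\<close> by simp
  qed
  \<comment> \<open>Here \<open>1 \<le> m\<close> discards the primes of \<open>R\<close> that are
    not some \<open>b t\<close>; their multiplicity is 0.\<close>
  have "{r \<in> R. m \<le> multiplicity r (\<Prod>t\<in>I. b t ^ e t)} = b ` {t \<in> I. b t \<in> R \<and> m \<le> e t}"
    using m inj by (auto simp: mult split: if_splits)
  moreover have "inj_on b {t \<in> I. b t \<in> R \<and> m \<le> e t}"
    using inj by (rule inj_on_subset) auto
  ultimately show ?thesis by (simp add: card_image)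
qed

lemma finite_suppterms:
  assumes "\<alpha> \<in> Alphas"
  shows "finite (suppterms \<alpha>)"
  using is_listing_suppterms[OF assms] by (simp add: is_listing_def)

lemma finite_restr_support:
  assumes "\<alpha> \<in> Alphas" "p \<in> betacl Primes" "1 \<le> m"
  shows "finite {k. m \<le> k \<and> restr \<alpha> p k \<noteq> 0}"
proof (rule finite_subset)
  show "{k. m \<le> k \<and> restr \<alpha> p k \<noteq> 0} \<subseteq> snd ` suppterms \<alpha>"
    using assms(2,3) by (force simp: suppterms_def restr_def Npos_def)
  show "finite (snd ` suppterms \<alpha>)"
    using finite_suppterms[OF assms(1)] by simp
qed

lemma prodset_pos:
  assumes "n \<in> prodset \<alpha> L A" and "\<And>i. i \<in> L \<Longrightarrow> A i \<subseteq> Primes"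
  shows "0 < n"
proof -
  from assms(1) obtain a
    where n: "n = (\<Prod>(p, k)\<in>L. \<Prod>j = 1..\<alpha> (upow p k). a (p, k) j ^ k)"
      and a: "\<forall>(p, k)\<in>L. \<forall>j\<in>{1..\<alpha> (upow p k)}. a (p, k) j \<in> A (p, k)"
    unfolding prodset_def by blast
  have "0 < a (p, k) j" if "(p, k) \<in> L" "j \<in> {1..\<alpha> (upow p k)}" for p k j
  proof -
    have "a (p, k) j \<in> Primes" using a assms(2)[OF that(1)] that by blast
    then show ?thesis by (auto simp: Primes_def intro: prime_gt_0_nat)
  qed
  then show ?thesis unfolding n by (auto intro!: prod_pos)
qed

text \<open>By disjointness, a factor lies in \<open>D p\<close> only if its term belongs to
  \<open>p\<close>. Each term \<open>(p, k)\<close> with \<open>m \<le> k\<close> contributes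
  \<open>restr \<alpha> p k\<close> distinct primes, so the count does not depend on the choice of
  \<open>n\<close>.\<close>

lemma card_multiplicity_prodset:
  assumes \<alpha>: "\<alpha> \<in> Alphas" and p: "p \<in> betacl Primes" and m: "1 \<le> m"
    and D: "\<And>q. D q \<subseteq> Primes"
    and disj: "\<And>q. q \<in> fst ` suppterms \<alpha> \<Longrightarrow> q \<noteq> p \<Longrightarrow> D q \<inter> D p = {}"
    and n: "n \<in> prodset \<alpha> (suppterms \<alpha>) (\<lambda>i. D (fst i))"
  shows "card {r \<in> D p. m \<le> multiplicity r n} = (\<Sum>k | m \<le> k \<and> restr \<alpha> p k \<noteq> 0. restr \<alpha> p k)"
proof -
  let ?L = "suppterms \<alpha>"
  let ?J = "\<lambda>i. {1..\<alpha> (upow (fst i) (snd i))}"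
  let ?K = "{k. m \<le> k \<and> restr \<alpha> p k \<noteq> 0}"
  define I where "I = Sigma ?L ?J"
  from n obtain a
    where n_eq: "n = (\<Prod>(p, k)\<in>?L. \<Prod>j = 1..\<alpha> (upow p k). a (p, k) j ^ k)"
      and a: "\<forall>(p, k)\<in>?L. \<forall>j\<in>{1..\<alpha> (upow p k)}. a (p, k) j \<in> D (fst (p, k))"
      and inj: "inj_on (\<lambda>(i, j). a i j) I"
    unfolding prodset_def I_def by blast
  let ?b = "\<lambda>(i, j). a i j"
  have fin: "finite ?L" using finite_suppterms[OF \<alpha>] .
  have a_D: "?b t \<in> D (fst (fst t))" if "t \<in> I" for t
    using a that by (fastforce simp: I_def)
  \<comment> \<open>The nested product becomes one product over indices \<open>((q, k), j)\<close>,
    where the injectivity of the factors applies across all terms.\<close>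
  have n_flat: "n = (\<Prod>t\<in>I. ?b t ^ snd (fst t))"
    unfolding n_eq I_def using fin
    by (simp add: prod.Sigma case_prod_unfold)
  have "card {r \<in> D p. m \<le> multiplicity r n} = card {t \<in> I. ?b t \<in> D p \<and> m \<le> snd (fst t)}"
    unfolding n_flat
  proof (rule card_multiplicity_prod_primes[OF _ inj _ _ m])
    show "finite I" unfolding I_def using fin by simp
    show "prime (?b t)" if "t \<in> I" for t
      using a_D[OF that] D by (auto simp: Primes_def)
    show "prime r" if "r \<in> D p" for r using that D by (auto simp: Primes_def)
  qed
  also have "{t \<in> I. ?b t \<in> D p \<and> m \<le> snd (fst t)} = Sigma (Pair p ` ?K) ?J"
  proof (rule set_eqI)
    fix t :: "(nat set set \<times> nat) \<times> nat"
    obtain q k j where t: "t = ((q, k), j)" by (metis prod.exhaust)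
    have "q = p" if "t \<in> I" "?b t \<in> D p"
    proof (rule ccontr)
      assume "q \<noteq> p"
      moreover have "q \<in> fst ` ?L" using that(1) by (force simp: t I_def)
      ultimately have "D q \<inter> D p = {}" using disj by blast
      then show False using a_D[OF that(1)] that(2) by (auto simp: t)
    qed
    \<comment> \<open>A \<open>j\<close> in \<open>{1..\<alpha> (upow p k)}\<close> already forces a
      nonzero value, and \<open>1 \<le> m\<close> puts \<open>k\<close> into
      \<open>Npos\<close>.\<close>
    moreover have "t \<in> I \<longleftrightarrow> k \<in> ?K \<and> j \<in> ?J (q, k)" if "q = p" "m \<le> k"
      using that p m by (auto simp: t I_def suppterms_def restr_def Npos_def)
    ultimately show "t \<in> {t \<in> I. ?b t \<in> D p \<and> m \<le> snd (fst t)} \<longleftrightarrow> t \<in> Sigma (Pair p ` ?K) ?J"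
      using a_D[of t] by (auto simp: t)
  qed
  also have "card (Sigma (Pair p ` ?K) ?J) = (\<Sum>k\<in>?K. restr \<alpha> p k)"
    using finite_restr_support[OF \<alpha> p m]
    by (simp add: sum.reindex inj_on_def restr_def)
  finally show ?thesis .
qed

text \<open>The set attached to a term depends only on its ultrafilter, so terms with the same
  ultrafilter share one set. \<open>S\<close> may exceed the support, which lets one
  \<open>D\<close> serve several functions.\<close>

lemma prodset_in_Fam:
  assumes "fst ` suppterms \<alpha> \<subseteq> S" "S \<subseteq> betacl Primes"
    and "\<And>p. p \<in> S \<Longrightarrow> D p \<in> p" "\<And>p. D p \<subseteq> Primes"
    and "\<And>p q. p \<in> S \<Longrightarrow> q \<in> S \<Longrightarrow> p \<noteq> q \<Longrightarrow> D p \<inter> D q = {}"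
  shows "prodset \<alpha> (suppterms \<alpha>) (\<lambda>i. D (fst i)) \<in> Fam \<alpha>"
proof -
  have S: "fst i \<in> S" if "i \<in> suppterms \<alpha>" for i
    using assms(1) that by blast
  have "D (fst i) \<in> restrP (fst i)" if "i \<in> suppterms \<alpha>" for i
    using S[OF that] assms(2-4) restrP_iff by blast
  moreover have "D (fst i) \<inter> D (fst j) = {}"
    if "i \<in> suppterms \<alpha>" "j \<in> suppterms \<alpha>" "fst i \<noteq> fst j" for i j
    using S that assms(5) by blast
  ultimately show ?thesis
    unfolding Fam_def Fam_on_def mem_Collect_eq
    by (intro exI[of _ "\<lambda>i. D (fst i)"] conjI refl) (simp_all add: split_def)
qed

lemma card_multiplicity_mono:
  fixes u v :: nat
  assumes "u dvd v" "0 < v" and R: "\<And>r. r \<in> R \<Longrightarrow> prime r" and m: "1 \<le> m"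
  shows "card {r \<in> R. m \<le> multiplicity r u} \<le> card {r \<in> R. m \<le> multiplicity r v}"
proof (rule card_mono)
  \<comment> \<open>\<open>R\<close> may be infinite, but the counted primes divide
    \<open>v\<close>.\<close>
  show "finite {r \<in> R. m \<le> multiplicity r v}"
  proof (rule finite_subset)
    show "{r \<in> R. m \<le> multiplicity r v} \<subseteq> prime_factors v"
      using R m by (auto simp: prime_factors_multiplicity)
  qed simp
  \<comment> \<open>Multiplicities grow along divisibility only for \<open>v\<close> nonzero, since
    \<open>multiplicity r 0\<close> is 0 by convention.\<close>
  show "{r \<in> R. m \<le> multiplicity r u} \<subseteq> {r \<in> R. m \<le> multiplicity r v}"
    using dvd_imp_multiplicity_le[OF assms(1)] assms(2) by (auto intro: order_trans)
qed

text \<open>The upward closure of \<open>X\<close> is an up-set in \<open>x\<close>, hence also in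
  \<open>y\<close>, and so it meets \<open>Y\<close>; a common element is a multiple of some element
  of \<open>X\<close>.\<close>

lemma tilde_dvd_elements:
  assumes x: "x \<in> betaN" and y: "y \<in> betaN" and dvd: "tilde_dvd x y" and "X \<in> x" "Y \<in> y"
  obtains u v where "u \<in> X" "v \<in> Y" "u dvd v"
proof -
  have X: "X \<subseteq> upclose X" "upclose X \<subseteq> Npos"
    using betaN_sub[OF x \<open>X \<in> x\<close>] by (auto simp: upclose_def intro: dvd_refl)
  have "upclose X \<in> Upsets"
    unfolding Upsets_def upclose_def by (auto intro: dvd_trans)
  moreover have "upclose X \<in> x" using betaN_up[OF x \<open>X \<in> x\<close> X] .
  ultimately have "upclose X \<in> y" using dvd by (auto simp: tilde_dvd_def)
  then have "upclose X \<inter> Y \<noteq> {}"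
    using betaN_Int[OF y _ \<open>Y \<in> y\<close>] betaN_nonempty[OF y] by blast
  then show thesis using that by (auto simp: upclose_def)
qed

lemma tilde_dvd_imp_alpha_le:
  assumes \<alpha>: "\<alpha> \<in> Alphas" and \<beta>: "\<beta> \<in> Alphas" and x: "x \<in> betaN" and y: "y \<in> betaN"
    and Fx: "Fam \<alpha> \<subseteq> x" and Fy: "Fam \<beta> \<subseteq> y" and dvd: "tilde_dvd x y"
  shows "alpha_le \<alpha> \<beta>"
  unfolding alpha_le_def dominates_def
proof (intro ballI)
  fix p m assume p: "p \<in> betacl Primes" and "m \<in> Npos"
  then have m: "1 \<le> m" by (simp add: Npos_def)
  \<comment> \<open>Both supports are included so that the same \<open>D\<close> yields both product
    sets; \<open>p\<close> is inserted because it may occur in neither, yet \<open>D p\<close> must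
    be disjoint from the other sets.\<close>
  define S where "S = insert p (fst ` suppterms \<alpha> \<union> fst ` suppterms \<beta>)"
  have "finite S" unfolding S_def using finite_suppterms \<alpha> \<beta> by simp
  moreover have S: "S \<subseteq> betacl Primes" unfolding S_def using p by (auto simp: suppterms_def)
  ultimately obtain D where D: "\<And>p. p \<in> S \<Longrightarrow> D p \<in> p" "\<And>p. D p \<subseteq> Primes"
    "\<And>p q. p \<in> S \<Longrightarrow> q \<in> S \<Longrightarrow> p \<noteq> q \<Longrightarrow> D p \<inter> D q = {}"
    by (rule separate_finite) blast
  let ?prods = "\<lambda>\<gamma>. prodset \<gamma> (suppterms \<gamma>) (\<lambda>i. D (fst i))"
  have "?prods \<alpha> \<in> x" by (rule subsetD[OF Fx prodset_in_Fam[OF _ S D]]) (auto simp: S_def)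
  moreover have "?prods \<beta> \<in> y" by (rule subsetD[OF Fy prodset_in_Fam[OF _ S D]]) (auto simp: S_def)
  ultimately obtain u v where u: "u \<in> ?prods \<alpha>" and v: "v \<in> ?prods \<beta>" and "u dvd v"
    by (rule tilde_dvd_elements[OF x y dvd])
  have "(\<Sum>k | m \<le> k \<and> restr \<alpha> p k \<noteq> 0. restr \<alpha> p k) = card {r \<in> D p. m \<le> multiplicity r u}"
    by (rule card_multiplicity_prodset[OF \<alpha> p m D(2) _ u, symmetric], rule D(3)) (auto simp: S_def)
  also have "\<dots> \<le> card {r \<in> D p. m \<le> multiplicity r v}"
    using \<open>u dvd v\<close> prodset_pos[OF v D(2)] D(2) m
    by (intro card_multiplicity_mono) (auto simp: Primes_def)
  also have "\<dots> = (\<Sum>k | m \<le> k \<and> restr \<beta> p k \<noteq> 0. restr \<beta> p k)"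
    by (rule card_multiplicity_prodset[OF \<beta> p m D(2) _ v], rule D(3)) (auto simp: S_def)
  finally show "(\<Sum>k | m \<le> k \<and> restr \<alpha> p k \<noteq> 0. restr \<alpha> p k)
    \<le> (\<Sum>k | m \<le> k \<and> restr \<beta> p k \<noteq> 0. restr \<beta> p k)" .
qed

text \<open>Recovers \<open>f m\<close> as a difference of consecutive tail sums. Finiteness matters
  because a sum over an infinite set is 0 by default.\<close>

lemma tail_sum_Suc:
  fixes f :: "nat \<Rightarrow> nat"
  assumes "finite {k. m \<le> k \<and> f k \<noteq> 0}"
  shows "(\<Sum>k | m \<le> k \<and> f k \<noteq> 0. f k) = f m + (\<Sum>k | Suc m \<le> k \<and> f k \<noteq> 0. f k)"
proof (cases "f m = 0")
  case True
  then have "{k. m \<le> k \<and> f k \<noteq> 0} = {k. Suc m \<le> k \<and> f k \<noteq> 0}"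
    by (auto simp: Suc_le_eq le_less)
  with True show ?thesis by simp
next
  case False
  then have "{k. m \<le> k \<and> f k \<noteq> 0} = insert m {k. Suc m \<le> k \<and> f k \<noteq> 0}"
    by auto
  moreover have "finite {k. Suc m \<le> k \<and> f k \<noteq> 0}"
    using assms by (rule rev_finite_subset) auto
  ultimately show ?thesis by simp
qed

lemma alpha_le_antisym:
  assumes \<alpha>: "\<alpha> \<in> Alphas" and \<beta>: "\<beta> \<in> Alphas" and "alpha_le \<alpha> \<beta>" "alpha_le \<beta> \<alpha>"
  shows "\<alpha> = \<beta>"
proof
  fix b
  show "\<alpha> b = \<beta> b"
  proof (cases "b \<in> Basic")
    \<comment> \<open>Off \<open>Basic\<close> both functions carry the default value 0.\<close>
    case False
    then show ?thesis using \<alpha> \<beta> by (simp add: Alphas_def)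
  next
    case True
    then obtain p k where b: "b = upow p k" and p: "p \<in> betacl Primes" and k: "1 \<le> k"
      by (auto simp: Basic_def Npos_def)
    let ?T = "\<lambda>\<gamma> m. \<Sum>k | m \<le> k \<and> restr \<gamma> p k \<noteq> 0. restr \<gamma> p k"
    have eq: "?T \<alpha> m = ?T \<beta> m" if "1 \<le> m" for m
      using assms(3,4) p that unfolding alpha_le_def dominates_def
      by (intro antisym) (auto simp: Npos_def)
    \<comment> \<open>Subtract the equal tails from \<open>Suc k\<close> on from the equal tails
      from \<open>k\<close> on.\<close>
    have "restr \<alpha> p k = restr \<beta> p k"
      using eq[OF k] eq[of "Suc k"] tail_sum_Suc[OF finite_restr_support[OF \<alpha> p k]]
        tail_sum_Suc[OF finite_restr_support[OF \<beta> p k]] by simp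
    then show ?thesis by (simp add: restr_def b)
  qed
qed

theorem theorem5p8:
  fixes \<alpha> \<beta> :: "nat set set \<Rightarrow> nat"
  assumes "\<alpha> \<in> Alphas" and "\<beta> \<in> Alphas"
  shows "(\<forall>x\<in>betaN. \<forall>y\<in>betaN. Fam \<alpha> \<subseteq> x \<and> Fam \<beta> \<subseteq> y \<and> tilde_dvd x y \<longrightarrow> alpha_le \<alpha> \<beta>)
       \<and> (\<alpha> \<noteq> \<beta> \<longrightarrow> \<not> (\<exists>x\<in>betaN. Fam \<alpha> \<union> Fam \<beta> \<subseteq> x))"
proof (intro conjI ballI impI notI)
  fix x y assume "x \<in> betaN" "y \<in> betaN" "Fam \<alpha> \<subseteq> x \<and> Fam \<beta> \<subseteq> y \<and> tilde_dvd x y"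
  then show "alpha_le \<alpha> \<beta>" using tilde_dvd_imp_alpha_le[OF assms] by blast
next
  assume "\<alpha> \<noteq> \<beta>" "\<exists>x\<in>betaN. Fam \<alpha> \<union> Fam \<beta> \<subseteq> x"
  then obtain x where x: "x \<in> betaN" "Fam \<alpha> \<subseteq> x" "Fam \<beta> \<subseteq> x" by blast
  have "tilde_dvd x x" by (simp add: tilde_dvd_def)
  with x assms have "alpha_le \<alpha> \<beta>" "alpha_le \<beta> \<alpha>"
    by (blast intro: tilde_dvd_imp_alpha_le)+
  with assms \<open>\<alpha> \<noteq> \<beta>\<close> show False using alpha_le_antisym by blast
qed

end
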